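(* For the triangle game on the triangular grid with $n$ winning sets, $\mathrm{SC}_2(\mathcal G_{\triangle},1)\ge \frac{3n}{4}-o(n)$.
   Context: An $s$-of-$k$ game on a $k$-uniform hypergraph $(V,\mathcal F)$ (winning sets are $k$-element subsets of the finite set $V$), $1\le s\le k$: Maker and Breaker alternately claim unclaimed vertices, Maker first, until all are claimed; the score is the number of winning sets in which Maker claimed at least $s$ vertices (Maker maximizes, Breaker minimizes). A pairing strategy for Maker: she fixes in advance pairwise disjoint pairs of vertices and, whenever Breaker claims a vertex of a pair whose partner is unclaimed, she claims the partner (other moves arbitrary). $\mathrm{SC}_2(\mathcal H,s)$ is the largest score Maker can guarantee against every Breaker strategy using a pairing strategy. $\mathcal G_{\triangle}$ is the hypergraph whose vertices are the points of a finite portion of the triangular lattice (the plane tiled by unit equilateral triangles) and whose winning sets are the vertex sets of the unit triangular faces (both orientations), so $k=3$. Grids are assumed "two-dimensional": the number of winning sets within constant distance of the boundary is $o(n)$, where $n$ is the number of winning sets; $o(n)$ refers to $n\to\infty$. *)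

theory Defs
  imports Complex_Main "HOL-Library.Landau_Symbols"
begin

section \<open>Maker-Breaker \<open>s\<close>-of-\<open>k\<close> games and pairing strategies\<close>

text \<open>
  A position is the list of the vertices claimed so far, in chronological order. Maker moves
  first, so she made the moves with even index, and it is her turn iff the length is even.
\<close>

definition position :: "'a set \<Rightarrow> 'a list \<Rightarrow> bool" where
  "position V h \<longleftrightarrow> distinct h \<and> set h \<subseteq> V"

definition maker_strategy :: "'a set \<Rightarrow> ('a list \<Rightarrow> 'a) \<Rightarrow> bool" where
  "maker_strategy V \<sigma> \<longleftrightarrow>
    (\<forall>h. position V h \<and> set h \<noteq> V \<and> even (length h) \<longrightarrow> \<sigma> h \<in> V - set h)"

definition breaker_strategy :: "'a set \<Rightarrow> ('a list \<Rightarrow> 'a) \<Rightarrow> bool" where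
  "breaker_strategy V \<tau> \<longleftrightarrow>
    (\<forall>h. position V h \<and> set h \<noteq> V \<and> odd (length h) \<longrightarrow> \<tau> h \<in> V - set h)"

primrec play :: "('a list \<Rightarrow> 'a) \<Rightarrow> ('a list \<Rightarrow> 'a) \<Rightarrow> nat \<Rightarrow> 'a list" where
  "play \<sigma> \<tau> 0 = []"
| "play \<sigma> \<tau> (Suc t) =
    play \<sigma> \<tau> t @ [if even t then \<sigma> (play \<sigma> \<tau> t) else \<tau> (play \<sigma> \<tau> t)]"

definition maker_vertices :: "'a list \<Rightarrow> 'a set" where
  "maker_vertices h = {h ! i | i. i < length h \<and> even i}"

definition score ::
    "'a set \<Rightarrow> 'a set set \<Rightarrow> nat \<Rightarrow> ('a list \<Rightarrow> 'a) \<Rightarrow> ('a list \<Rightarrow> 'a) \<Rightarrow> nat" where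
  "score V \<F> s \<sigma> \<tau> =
    card {W \<in> \<F>. s \<le> card (W \<inter> maker_vertices (play \<sigma> \<tau> (card V)))}"

definition pairing :: "'a set \<Rightarrow> 'a set set \<Rightarrow> bool" where
  "pairing V P \<longleftrightarrow> (\<forall>p\<in>P. p \<subseteq> V \<and> card p = 2) \<and> pairwise disjnt P"

definition pairing_strategy :: "'a set \<Rightarrow> 'a set set \<Rightarrow> ('a list \<Rightarrow> 'a) \<Rightarrow> bool" where
  "pairing_strategy V P \<sigma> \<longleftrightarrow> maker_strategy V \<sigma> \<and>
    (\<forall>h b w. position V (h @ [b]) \<and> odd (length h) \<and> {b, w} \<in> P \<and> w \<notin> set h
       \<longrightarrow> \<sigma> (h @ [b]) = w)"

text \<open>
  Maker commits herself only to the set \<open>P\<close> of pairs. Her moves that \<open>P\<close> does not dictate are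
  arbitrary, so the guarantee has to hold for \<^emph>\<open>every\<close> strategy \<open>\<sigma>\<close> that respects \<open>P\<close>. (With an
  existentially quantified \<open>\<sigma>\<close>, the empty pairing would admit all Maker strategies.)
\<close>

definition pairing_guarantees :: "'a set \<Rightarrow> 'a set set \<Rightarrow> nat \<Rightarrow> 'a set set \<Rightarrow> nat \<Rightarrow> bool" where
  "pairing_guarantees V \<F> s P m \<longleftrightarrow>
    (\<forall>\<sigma> \<tau>. pairing_strategy V P \<sigma> \<and> breaker_strategy V \<tau> \<longrightarrow> m \<le> score V \<F> s \<sigma> \<tau>)"

definition SC2 :: "'a set \<Rightarrow> 'a set set \<Rightarrow> nat \<Rightarrow> nat" where
  "SC2 V \<F> s = Max {m. \<exists>P. pairing V P \<and> pairing_guarantees V \<F> s P m}"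


text \<open>For finite hypergraphs, the maximum defining \<^const>\<open>SC2\<close> is taken over a finite nonempty set.\<close>

lemma ex_breaker_strategy: "\<exists>\<tau>. breaker_strategy V \<tau>"
proof -
  have "(SOME v. v \<in> V - set h) \<in> V - set h" if "set h \<subseteq> V" "set h \<noteq> V" for h
    using that by (intro some_in_eq[THEN iffD2]) auto
  then have "breaker_strategy V (\<lambda>h. SOME v. v \<in> V - set h)"
    unfolding breaker_strategy_def position_def by blast
  then show ?thesis by blast
qed

lemma pairing_partner_unique:
  assumes "pairing V P" "{b, w} \<in> P" "{b, w'} \<in> P"
  shows "w = w'"
proof -
  have "\<not> disjnt {b, w} {b, w'}" by (simp add: disjnt_def)
  then have "{b, w} = {b, w'}"
    using assms pairwiseD[of disjnt P "{b, w}" "{b, w'}"] by (metis pairing_def)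
  then show ?thesis by (auto simp: doubleton_eq_iff)
qed

lemma ex_pairing_strategy:
  assumes "pairing V P"
  shows "\<exists>\<sigma>. pairing_strategy V P \<sigma>"
proof -
  define reply where "reply h w \<longleftrightarrow> h \<noteq> [] \<and> {last h, w} \<in> P \<and> w \<notin> set h" for h w
  define \<sigma> where "\<sigma> h = (if \<exists>w. reply h w then (THE w. reply h w)
    else (SOME v. v \<in> V - set h))" for h
  have \<sigma>_reply: "\<sigma> h = w" if "reply h w" for h w
  proof -
    have "w' = w" if "reply h w'" for w'
      using \<open>reply h w\<close> that unfolding reply_def
      by (elim conjE) (rule pairing_partner_unique[OF assms])
    then have "(THE w. reply h w) = w"
      using that by (intro the_equality)
    moreover have "\<exists>w. reply h w" using that ..
    ultimately show ?thesis by (simp only: \<sigma>_def if_True)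
  qed
  have "maker_strategy V \<sigma>"
    unfolding maker_strategy_def
  proof (intro allI impI)
    fix h assume h: "position V h \<and> set h \<noteq> V \<and> even (length h)"
    show "\<sigma> h \<in> V - set h"
    proof (cases "\<exists>w. reply h w")
      case True
      then obtain w where w: "reply h w" by blast
      then show ?thesis
        using \<sigma>_reply[OF w] assms by (auto simp: reply_def pairing_def)
    next
      case False
      have "(SOME v. v \<in> V - set h) \<in> V - set h"
        using h by (intro some_in_eq[THEN iffD2]) (auto simp: position_def)
      then show ?thesis using False by (simp add: \<sigma>_def)
    qed
  qed
  moreover have "\<sigma> (h @ [b]) = w" if "{b, w} \<in> P" "w \<notin> set h" for h b w
  proof (rule \<sigma>_reply)
    have "w \<noteq> b" using assms that by (auto simp: pairing_def)
    then show "reply (h @ [b]) w" using that by (auto simp: reply_def)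
  qed
  ultimately show ?thesis unfolding pairing_strategy_def by blast
qed

lemma SC2_set_finite_nonempty:
  assumes "finite \<F>"
  shows "finite {m. \<exists>P. pairing V P \<and> pairing_guarantees V \<F> s P m}" (is "finite ?M")
    and "{m. \<exists>P. pairing V P \<and> pairing_guarantees V \<F> s P m} \<noteq> {}"
proof -
  have "?M \<subseteq> {.. card \<F>}"
  proof clarify
    fix m P assume "pairing V P" "pairing_guarantees V \<F> s P m"
    moreover obtain \<sigma> \<tau> where "pairing_strategy V P \<sigma>" "breaker_strategy V \<tau>"
      using ex_pairing_strategy ex_breaker_strategy \<open>pairing V P\<close> by metis
    ultimately have "m \<le> score V \<F> s \<sigma> \<tau>" by (auto simp: pairing_guarantees_def)
    also have "\<dots> \<le> card \<F>" unfolding score_def by (intro card_mono assms) auto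
    finally show "m \<le> card \<F>" .
  qed
  then show "finite ?M" by (rule finite_subset) simp
  have "pairing V {}" by (simp add: pairing_def)
  moreover have "pairing_guarantees V \<F> s {} 0" by (simp add: pairing_guarantees_def)
  ultimately show "?M \<noteq> {}" by blast
qed


section \<open>The triangular grid\<close>

text \<open>
  The pair \<open>(a, b)\<close> stands for the lattice point \<open>a + b \<omega>\<close> of the complex plane, where
  \<open>\<omega> = exp (i \<pi> / 3)\<close>.
\<close>

definition tri_point :: "int \<times> int \<Rightarrow> complex" where
  "tri_point p = of_int (fst p) + of_int (snd p) * cis (pi / 3)"

definition tri_dist :: "int \<times> int \<Rightarrow> int \<times> int \<Rightarrow> real" where
  "tri_dist p q = dist (tri_point p) (tri_point q)"

definition tri_faces :: "(int \<times> int) set \<Rightarrow> (int \<times> int) set set" where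
  "tri_faces V = {T. T \<subseteq> V \<and>
    (\<exists>a b. T = {(a, b), (a + 1, b), (a, b + 1)} \<or>
           T = {(a + 1, b), (a, b + 1), (a + 1, b + 1)})}"

definition tri_boundary :: "(int \<times> int) set \<Rightarrow> (int \<times> int) set" where
  "tri_boundary V = {p \<in> V. \<exists>q. q \<notin> V \<and> tri_dist p q = 1}"

definition tri_faces_near_boundary :: "(int \<times> int) set \<Rightarrow> real \<Rightarrow> (int \<times> int) set set" where
  "tri_faces_near_boundary V d =
    {T \<in> tri_faces V. \<exists>p\<in>T. \<exists>q\<in>tri_boundary V. tri_dist p q \<le> d}"

definition two_dimensional :: "(nat \<Rightarrow> (int \<times> int) set) \<Rightarrow> bool" where
  "two_dimensional V \<longleftrightarrow>
    (\<forall>d. (\<lambda>i. real (card (tri_faces_near_boundary (V i) d)))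
           \<in> o(\<lambda>i. real (card (tri_faces (V i)))))"


lemma tri_dist_sq:
  "(tri_dist (a, b) (c, d))\<^sup>2 = real_of_int ((c - a)\<^sup>2 + (c - a) * (d - b) + (d - b)\<^sup>2)"
proof -
  define x y where "x = real_of_int (c - a)" and "y = real_of_int (d - b)"
  have "Re (tri_point (c, d) - tri_point (a, b)) = x + y / 2"
    by (simp add: tri_point_def x_def y_def cos_60 field_simps)
  moreover have "Im (tri_point (c, d) - tri_point (a, b)) = y * (sqrt 3 / 2)"
    by (simp add: tri_point_def y_def sin_60 left_diff_distrib diff_divide_distrib)
  ultimately have "(tri_dist (a, b) (c, d))\<^sup>2 = (x + y / 2)\<^sup>2 + (y * (sqrt 3 / 2))\<^sup>2"
    by (simp only: tri_dist_def dist_norm norm_minus_commute[of "tri_point (a, b)"] cmod_power2)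
  also have "\<dots> = (x + y / 2)\<^sup>2 + y\<^sup>2 * (3 / 4)"
    by (simp add: power_mult_distrib power_divide)
  also have "\<dots> = x\<^sup>2 + x * y + y\<^sup>2"
    by (simp add: power2_eq_square algebra_simps)
  finally show ?thesis by (simp add: x_def y_def)
qed

lemma tri_dist_eq_1_iff:
  "tri_dist (a, b) (c, d) = 1 \<longleftrightarrow>
    (c - a, d - b) \<in> {(1, 0), (0, 1), (-1, 1), (-1, 0), (0, -1), (1, -1)}"
proof -
  define x y where "x = c - a" and "y = d - b"
  have "tri_dist (a, b) (c, d) \<ge> 0" by (simp add: tri_dist_def)
  then have "tri_dist (a, b) (c, d) = 1 \<longleftrightarrow> (tri_dist (a, b) (c, d))\<^sup>2 = 1"
    by (simp add: power2_eq_1_iff)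
  also have "\<dots> \<longleftrightarrow> x\<^sup>2 + x * y + y\<^sup>2 = 1"
    unfolding tri_dist_sq x_def y_def by (metis of_int_1 of_int_eq_iff)
  also have "\<dots> \<longleftrightarrow> (x, y) \<in> {(1, 0), (0, 1), (-1, 1), (-1, 0), (0, -1), (1, -1)}"
  proof
    assume eq: "x\<^sup>2 + x * y + y\<^sup>2 = 1"
    have "3 * x\<^sup>2 + (x + 2 * y)\<^sup>2 = 4" "3 * y\<^sup>2 + (2 * x + y)\<^sup>2 = 4"
      using eq by (simp_all add: power2_eq_square algebra_simps)
    then have "x\<^sup>2 \<le> 1" "y\<^sup>2 \<le> 1"
      using zero_le_power2[of "x + 2 * y"] zero_le_power2[of "2 * x + y"] by linarith+
    then have "\<bar>x\<bar> \<le> 1" "\<bar>y\<bar> \<le> 1" by (simp_all add: abs_square_le_1)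
    then have "x \<in> {-1, 0, 1}" "y \<in> {-1, 0, 1}" by auto
    then show "(x, y) \<in> {(1, 0), (0, 1), (-1, 1), (-1, 0), (0, -1), (1, -1)}"
      using eq by auto
  qed auto
  finally show ?thesis by (simp add: x_def y_def)
qed

end

theory Submission imports Defs begin

text \<open>
  Pair the lattice points \<open>(2k, b)\<close> and \<open>(2k + 1, b)\<close>. Maker obtains at least one vertex of every
  pair. The faces split into groups of four: the face above the pair \<open>{(2k, b), (2k + 1, b)}\<close>, the
  face below the pair \<open>{(2k, b + 1), (2k + 1, b + 1)}\<close>, and two faces of which one contains
  \<open>(2k, b + 1)\<close> and the other \<open>(2k + 1, b + 1)\<close>. The first two faces are always hit, and so is at
  least one of the other two. Hence at most a quarter of the faces is missed, apart from the groups
  that the boundary cuts.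
\<close>

section \<open>Pairing strategies\<close>

lemma length_play [simp]: "length (play \<sigma> \<tau> t) = t"
  by (induction t) auto

lemma take_play: "t \<le> t' \<Longrightarrow> take t (play \<sigma> \<tau> t') = play \<sigma> \<tau> t"
  by (induction rule: dec_induct) auto

lemma play_nth:
  assumes "i < t"
  shows "play \<sigma> \<tau> t ! i = (if even i then \<sigma> (play \<sigma> \<tau> i) else \<tau> (play \<sigma> \<tau> i))"
proof -
  have "play \<sigma> \<tau> t ! i = take (Suc i) (play \<sigma> \<tau> t) ! i" by simp
  also have "\<dots> = play \<sigma> \<tau> (Suc i) ! i" by (subst take_play) (use assms in simp_all)
  finally show ?thesis by (simp add: nth_append)
qed

lemma position_play:
  assumes "maker_strategy V \<sigma>" "breaker_strategy V \<tau>" "finite V"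
  shows "t \<le> card V \<Longrightarrow> position V (play \<sigma> \<tau> t)"
proof (induction t)
  case 0
  then show ?case by (simp add: position_def)
next
  case (Suc t)
  then have pos: "position V (play \<sigma> \<tau> t)" by simp
  then have "card (set (play \<sigma> \<tau> t)) = t" by (simp add: position_def distinct_card)
  then have "set (play \<sigma> \<tau> t) \<noteq> V" using Suc.prems by auto
  then have "(if even t then \<sigma> (play \<sigma> \<tau> t) else \<tau> (play \<sigma> \<tau> t)) \<in> V - set (play \<sigma> \<tau> t)"
    using assms pos by (auto simp: maker_strategy_def breaker_strategy_def)
  then show ?case using pos by (auto simp: position_def)
qed

lemma set_play_card:
  assumes "maker_strategy V \<sigma>" "breaker_strategy V \<tau>" "finite V"
  shows "set (play \<sigma> \<tau> (card V)) = V"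
  using position_play[OF assms order_refl] assms(3)
  by (intro card_subset_eq) (auto simp: position_def distinct_card)

text \<open>Every vertex is claimed in the end. If Breaker took both vertices of a pair, the partner
  was still free when he took the first one, so Maker's immediate reply would have claimed
  it.\<close>

lemma pairing_strategy_claims:
  assumes "pairing_strategy V P \<sigma>" "breaker_strategy V \<tau>" "finite V" "pairing V P" "{x, y} \<in> P"
  shows "x \<in> maker_vertices (play \<sigma> \<tau> (card V)) \<or> y \<in> maker_vertices (play \<sigma> \<tau> (card V))"
proof -
  define n h where "n = card V" and "h = play \<sigma> \<tau> n"
  have maker: "maker_strategy V \<sigma>" using assms(1) by (simp add: pairing_strategy_def)
  have set_h: "set h = V"
    using set_play_card[OF maker assms(2,3)] by (simp add: h_def n_def)
  have dist: "distinct h"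
    using position_play[OF maker assms(2,3) order_refl] by (simp add: position_def h_def n_def)
  have len: "length h = n" by (simp add: h_def)
  have reply: "even j" if "i < j" "j < n" "odd i" "{h ! i, h ! j} \<in> P" for i j
  proof (rule ccontr)
    assume "odd j"
    \<comment> \<open>Both indices are odd, so they are not consecutive: \<open>Suc i\<close> is a
      Maker move strictly between them. Her forced reply there is \<open>h ! j\<close>, which
      contradicts the distinctness of \<open>h\<close>.\<close>
    with that have ij: "Suc i < j" by (metis Suc_lessI even_Suc)
    have hi: "take (Suc i) h = play \<sigma> \<tau> i @ [h ! i]"
      using that take_play[of i n \<sigma> \<tau>] by (simp add: take_Suc_conv_app_nth len h_def)
    have play_Suc: "play \<sigma> \<tau> (Suc i) = play \<sigma> \<tau> i @ [h ! i]"
      using that take_play[of "Suc i" n \<sigma> \<tau>] hi unfolding h_def by simp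
    have "position V (play \<sigma> \<tau> (Suc i))"
      using that by (intro position_play maker assms) (simp add: n_def)
    moreover have "h ! j \<notin> set (play \<sigma> \<tau> i)"
    proof -
      have "h ! j \<noteq> h ! l" if "l < i" for l
        using that \<open>i < j\<close> \<open>j < n\<close> dist len by (simp add: nth_eq_iff_index_eq)
      moreover have "play \<sigma> \<tau> i = take i h" using that take_play[of i n \<sigma> \<tau>] by (simp add: h_def)
      ultimately show ?thesis by (simp add: in_set_conv_nth) metis
    qed
    ultimately have "\<sigma> (play \<sigma> \<tau> (Suc i)) = h ! j"
      using assms(1) that(3,4) unfolding pairing_strategy_def play_Suc by simp
    then have "h ! Suc i = h ! j"
      using play_nth[of "Suc i" n \<sigma> \<tau>] ij that by (simp add: h_def del: play.simps)
    then show False using ij that dist len by (simp add: nth_eq_iff_index_eq)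
  qed
  have xy: "x \<noteq> y" "x \<in> V" "y \<in> V" using assms(4,5) by (auto simp: pairing_def)
  obtain i where i: "i < n" "x = h ! i"
    using xy set_h len by (metis in_set_conv_nth)
  obtain j where j: "j < n" "y = h ! j"
    using xy set_h len by (metis in_set_conv_nth)
  \<comment> \<open>Since \<open>x \<noteq> y\<close>, the indices differ, and \<open>reply\<close>
    applies with the earlier of the two vertices first.\<close>
  have "even i \<or> even j"
    using reply[of i j] reply[of j i] i j xy assms(5) by (metis insert_commute linorder_neqE_nat)
  then show ?thesis
    using i j len unfolding maker_vertices_def h_def[symmetric] n_def[symmetric] by blast
qed

lemma SC2_ge:
  assumes "finite \<F>" "pairing V P" "pairing_guarantees V \<F> s P m"
  shows "m \<le> SC2 V \<F> s"
  unfolding SC2_def using assms SC2_set_finite_nonempty(1) by (intro Max_ge) auto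

section \<open>Groups of four faces\<close>

definition up_face :: "int \<Rightarrow> int \<Rightarrow> (int \<times> int) set" where
  "up_face a b = {(a, b), (a + 1, b), (a, b + 1)}"

definition down_face :: "int \<Rightarrow> int \<Rightarrow> (int \<times> int) set" where
  "down_face a b = {(a + 1, b), (a, b + 1), (a + 1, b + 1)}"

definition quad :: "int \<times> int \<Rightarrow> (int \<times> int) set set" where
  "quad = (\<lambda>(k, b). {up_face (2 * k) b, down_face (2 * k) b,
                     up_face (2 * k + 1) b, down_face (2 * k - 1) b})"

text \<open>The coordinate sums are \<open>3a + 1, 3b + 1\<close> for an upward and \<open>3a + 2, 3b + 2\<close> for a downward face.\<close>

definition quad_index :: "(int \<times> int) set \<Rightarrow> int \<times> int" where
  "quad_index T = ((sum fst T + 1) div 6, sum snd T div 3)"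

lemma sum_fst_face:
  "sum fst (up_face a b) = 3 * a + 1" "sum fst (down_face a b) = 3 * a + 2"
  by (auto simp: up_face_def down_face_def)

lemma sum_snd_face:
  "sum snd (up_face a b) = 3 * b + 1" "sum snd (down_face a b) = 3 * b + 2"
  by (auto simp: up_face_def down_face_def)

lemma tri_faces_iff:
  "T \<in> tri_faces V \<longleftrightarrow> T \<subseteq> V \<and> (\<exists>a b. T = up_face a b \<or> T = down_face a b)"
  by (simp add: tri_faces_def up_face_def down_face_def)

text \<open>The first coordinate sums in the group \<open>(k, b)\<close> are \<open>6k + 1\<close>,
  \<open>6k + 2\<close>, \<open>6k + 4\<close> and \<open>6k - 1\<close>; raised by one they all lie
  in \<open>6k, ..., 6k + 5\<close>. As the index recovers the group, distinct groups are
  disjoint.\<close>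

lemma quad_index_eq: "T \<in> quad z \<Longrightarrow> quad_index T = z"
  unfolding quad_def quad_index_def
  by (auto simp: sum_fst_face sum_snd_face)

lemma finite_quad: "finite (quad z)"
  by (simp add: quad_def split: prod.split)

lemma card_quad: "card (quad z) = 4"
proof (cases z)
  case (Pair k b)
  \<comment> \<open>The four faces are told apart by their first coordinate sums.\<close>
  have "sum fst ` quad z = {6 * k + 1, 6 * k + 2, 6 * k + 4, 6 * k - 1}"
    by (simp add: Pair quad_def sum_fst_face add.commute)
  then have "4 = card (sum fst ` quad z)" by simp
  also have "\<dots> \<le> card (quad z)" by (intro card_image_le finite_quad)
  finally have "4 \<le> card (quad z)" .
  moreover have "card (quad z) \<le> 4"
    by (simp add: Pair quad_def card_insert_if)
  ultimately show ?thesis by simp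
qed

lemma face_in_quad:
  assumes "T \<in> tri_faces V"
  obtains z where "T \<in> quad z"
proof -
  obtain a b where T: "T = up_face a b \<or> T = down_face a b"
    using assms by (auto simp: tri_faces_iff)
  \<comment> \<open>For odd \<open>a\<close> the two faces at \<open>(a, b)\<close> go to different
    groups: the upward one to \<open>a div 2\<close>, the downward one to
    \<open>(a + 1) div 2\<close>.\<close>
  have "T \<in> quad (a div 2, b) \<or> T \<in> quad ((a + 1) div 2, b)"
  proof (cases "even a")
    case True
    then have "2 * (a div 2) = a" by simp
    then show ?thesis using T unfolding quad_def by auto
  next
    case False
    then have "2 * (a div 2) + 1 = a" "2 * ((a + 1) div 2) - 1 = a" by presburger+
    then show ?thesis using T unfolding quad_def by auto
  qed
  then show ?thesis using that by blast
qed

lemma finite_tri_faces: "finite V \<Longrightarrow> finite (tri_faces V)"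
  by (rule finite_subset[of _ "Pow V"]) (auto simp: tri_faces_def)

section \<open>Groups cut by the boundary\<close>

lemma quad_vertices:
  "\<Union> (quad (k, b)) = {(2 * k - 1, b + 1), (2 * k, b + 1), (2 * k + 1, b + 1),
                      (2 * k, b), (2 * k + 1, b), (2 * k + 2, b)}"
  by (auto simp: quad_def up_face_def down_face_def)

lemma quad_diameter:
  assumes "p \<in> \<Union> (quad z)" "q \<in> \<Union> (quad z)"
  shows "tri_dist p q \<le> 4"
proof -
  obtain k b where z: "z = (k, b)" by fastforce
  obtain p1 p2 q1 q2 where pq: "p = (p1, p2)" "q = (q1, q2)" by fastforce
  define x y where "x = q1 - p1" and "y = q2 - p2"
  have "\<bar>x\<bar> \<le> 3" "\<bar>y\<bar> \<le> 1"
    using assms unfolding z quad_vertices pq x_def y_def by auto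
  then have "x \<in> {-3, -2, -1, 0, 1, 2, 3}" "y \<in> {-1, 0, 1}" by auto
  \<comment> \<open>On this range the form is at most 13, and 16 is the next square. Any constant
    would serve, because \<open>two_dimensional\<close> covers every distance.\<close>
  then have "x\<^sup>2 + x * y + y\<^sup>2 \<le> 16" by auto
  then have "(tri_dist p q)\<^sup>2 \<le> 4\<^sup>2"
    unfolding pq tri_dist_sq x_def y_def by (simp only: power2_eq_square of_int_le_numeral_iff)
  then show ?thesis by (rule power2_le_imp_le) simp
qed

text \<open>The vertices of a group are connected by unit edges. If some lie in \<open>V\<close> and
  some do not, membership changes along such an edge, whose end in \<open>V\<close> is a boundary
  vertex; it is within the diameter bound 4 of \<open>T\<close>.\<close>

lemma cut_quad_near_boundary:
  assumes T: "T \<in> tri_faces V" "T \<in> quad z" and cut: "\<not> quad z \<subseteq> tri_faces V"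
  shows "T \<in> tri_faces_near_boundary V 4"
proof -
  obtain k b where z: "z = (k, b)" by fastforce
  define G where "G = \<Union> (quad z)"
  have TG: "T \<subseteq> G" using T by (auto simp: G_def)
  have "T \<noteq> {}" using T by (auto simp: tri_faces_iff up_face_def down_face_def)
  then obtain p where p: "p \<in> T" by blast
  have "\<not> G \<subseteq> V"
  proof
    assume "G \<subseteq> V"
    have "S \<in> tri_faces V" if S: "S \<in> quad z" for S
    proof -
      have "S \<subseteq> V" using S \<open>G \<subseteq> V\<close> unfolding G_def by blast
      moreover have "\<exists>a b. S = up_face a b \<or> S = down_face a b"
        using S unfolding z quad_def by blast
      ultimately show ?thesis by (simp only: tri_faces_iff)
    qed
    with cut show False by blast
  qed
  have "\<exists>q\<in>G. q \<in> tri_boundary V"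
  proof (rule ccontr)
    assume no: "\<not> ?thesis"
    have step: "q \<in> V \<longleftrightarrow> r \<in> V" if "q \<in> G" "r \<in> G" "tri_dist q r = 1" for q r
    proof -
      have "tri_dist r q = 1" using that by (simp add: tri_dist_def dist_commute)
      then show ?thesis using no that unfolding tri_boundary_def by blast
    qed
    note G = G_def[unfolded z quad_vertices]
    \<comment> \<open>These five unit edges form a spanning tree of the six vertices, so
      \<open>G\<close> lies entirely inside or entirely outside \<open>V\<close>.\<close>
    have "(2 * k - 1, b + 1) \<in> V \<longleftrightarrow> (2 * k, b + 1) \<in> V"
      and "(2 * k + 1, b + 1) \<in> V \<longleftrightarrow> (2 * k, b + 1) \<in> V"
      and "(2 * k, b) \<in> V \<longleftrightarrow> (2 * k, b + 1) \<in> V"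
      and "(2 * k + 1, b) \<in> V \<longleftrightarrow> (2 * k, b) \<in> V"
      and "(2 * k + 2, b) \<in> V \<longleftrightarrow> (2 * k + 1, b) \<in> V"
      by (rule step; simp add: G tri_dist_eq_1_iff)+
    then have "G \<subseteq> V \<or> G \<inter> V = {}" unfolding G by auto
    then show False using \<open>\<not> G \<subseteq> V\<close> p TG T(1) by (auto simp: tri_faces_iff)
  qed
  then obtain q where q: "q \<in> G" "q \<in> tri_boundary V" by blast
  have "tri_dist p q \<le> 4" using p q TG unfolding G_def by (intro quad_diameter) auto
  then show ?thesis using T(1) p q(2) unfolding tri_faces_near_boundary_def by blast
qed

section \<open>The horizontal pairing\<close>

text \<open>Pairs cut by the boundary are dropped. A group whose four faces all lie in
  \<open>V\<close> still has both its lower and its upper pair.\<close>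

definition row_pairs :: "(int \<times> int) set \<Rightarrow> (int \<times> int) set set" where
  "row_pairs V = {p. p \<subseteq> V \<and> (\<exists>k b. p = {(2 * k, b), (2 * k + 1, b)})}"

lemma pairing_row_pairs: "pairing V (row_pairs V)"
proof -
  \<comment> \<open>Halving the first coordinate of either vertex recovers the pair, so pairs that
    share a vertex coincide.\<close>
  have pair_eq: "p = {(2 * (fst v div 2), snd v), (2 * (fst v div 2) + 1, snd v)}"
    if p: "p \<in> row_pairs V" and v: "v \<in> p" for p v
  proof -
    obtain k b where "p = {(2 * k, b), (2 * k + 1, b)}"
      using p unfolding row_pairs_def by blast
    then show ?thesis using v by auto
  qed
  have "pairwise disjnt (row_pairs V)"
  proof (rule pairwiseI)
    fix p p' assume "p \<in> row_pairs V" "p' \<in> row_pairs V" "p \<noteq> p'"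
    then show "disjnt p p'" using pair_eq[of p] pair_eq[of p'] unfolding disjnt_iff by metis
  qed
  moreover have "p \<subseteq> V \<and> card p = 2" if p: "p \<in> row_pairs V" for p
  proof -
    obtain k b where "p = {(2 * k, b), (2 * k + 1, b)}"
      using p unfolding row_pairs_def by blast
    moreover have "p \<subseteq> V" using p unfolding row_pairs_def by blast
    ultimately show ?thesis by simp
  qed
  ultimately show ?thesis unfolding pairing_def by blast
qed

lemma row_pairs_misses:
  assumes hit: "\<And>x y. {x, y} \<in> row_pairs V \<Longrightarrow> x \<in> M \<or> y \<in> M"
    and full: "quad z \<subseteq> tri_faces V"
  shows "card {T \<in> quad z. T \<inter> M = {}} \<le> 1"
proof -
  obtain k b where z: "z = (k, b)" by fastforce
  have V: "\<Union> (quad z) \<subseteq> V" using full unfolding tri_faces_def by blast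
  have lower: "(2 * k, b) \<in> M \<or> (2 * k + 1, b) \<in> M"
    and upper: "(2 * k, b + 1) \<in> M \<or> (2 * k + 1, b + 1) \<in> M"
    using V unfolding z quad_vertices row_pairs_def by (blast intro!: hit[unfolded row_pairs_def])+
  have "up_face (2 * k) b \<inter> M \<noteq> {}" "down_face (2 * k) b \<inter> M \<noteq> {}"
    and "up_face (2 * k + 1) b \<inter> M \<noteq> {} \<or> down_face (2 * k - 1) b \<inter> M \<noteq> {}"
    using lower upper by (auto simp: up_face_def down_face_def)
  \<comment> \<open>\<open>S\<close> is the one face of \<open>up_face (2 * k + 1) b\<close> and
    \<open>down_face (2 * k - 1) b\<close> that can still be missed: each contains one vertex of the
    upper pair.\<close>
  then obtain S where "{T \<in> quad z. T \<inter> M = {}} \<subseteq> {S}"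
    unfolding z quad_def prod.case by blast
  then show ?thesis using card_mono[of "{S}" "{T \<in> quad z. T \<inter> M = {}}"] by simp
qed

section \<open>Counting the missed faces\<close>

lemma missed_faces_le:
  assumes "finite V" and hit: "\<And>x y. {x, y} \<in> row_pairs V \<Longrightarrow> x \<in> M \<or> y \<in> M"
  shows "4 * card {T \<in> tri_faces V. T \<inter> M = {}}
    \<le> card (tri_faces V) + 4 * card (tri_faces_near_boundary V 4)"
proof -
  define F N X where "F = tri_faces V" and "N = tri_faces_near_boundary V 4"
    and "X = {T \<in> tri_faces V. T \<inter> M = {}}"
  define K where "K = {z. quad z \<subseteq> F}"
  have finF: "finite F" using assms(1) by (simp add: F_def finite_tri_faces)
  have finN: "finite N" using finF by (simp add: N_def F_def tri_faces_near_boundary_def)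
  \<comment> \<open>Each complete group contains a face of the finite set \<open>F\<close>, and that
    face determines its index; hence \<open>K\<close> is finite.\<close>
  have "quad z \<noteq> {}" for z using card_quad[of z] by auto
  then have "K \<subseteq> quad_index ` F" using quad_index_eq unfolding K_def by blast
  then have finK: "finite K" using finF by (rule finite_surj[rotated])
  \<comment> \<open>A missed face lies in a complete group or, if its group is cut, near the
    boundary. The complete groups contribute at most one missed face each.\<close>
  have "X \<subseteq> N \<union> (\<Union>z\<in>K. {T \<in> quad z. T \<inter> M = {}})"
  proof
    fix T assume T: "T \<in> X"
    then obtain z where z: "T \<in> quad z" using face_in_quad unfolding X_def by blast
    then show "T \<in> N \<union> (\<Union>z\<in>K. {T \<in> quad z. T \<inter> M = {}})"
      using T cut_quad_near_boundary[of T V z] unfolding X_def N_def K_def F_def by blast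
  qed
  then have "card X \<le> card (N \<union> (\<Union>z\<in>K. {T \<in> quad z. T \<inter> M = {}}))"
    by (intro card_mono) (auto simp: finN finK finite_quad)
  also have "\<dots> \<le> card N + card (\<Union>z\<in>K. {T \<in> quad z. T \<inter> M = {}})" by (rule card_Un_le)
  also have "card (\<Union>z\<in>K. {T \<in> quad z. T \<inter> M = {}}) \<le> (\<Sum>z\<in>K. card {T \<in> quad z. T \<inter> M = {}})"
    by (rule card_UN_le[OF finK])
  also have "\<dots> \<le> (\<Sum>z\<in>K. 1)"
    using row_pairs_misses[OF hit] by (intro sum_mono) (simp add: K_def F_def)
  finally have "card X \<le> card N + card K" by simp
  \<comment> \<open>Disjoint groups of four faces inside \<open>F\<close> give
    \<open>4 * card K \<le> card F\<close>, which is where the quarter comes from.\<close>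
  moreover have "4 * card K = card (\<Union>z\<in>K. quad z)"
  proof -
    have "card (\<Union>z\<in>K. quad z) = (\<Sum>z\<in>K. card (quad z))"
      using finK finite_quad quad_index_eq by (intro card_UN_disjoint) blast+
    then show ?thesis by (simp add: card_quad)
  qed
  moreover have "card (\<Union>z\<in>K. quad z) \<le> card F"
    using finF by (intro card_mono) (auto simp: K_def)
  ultimately show ?thesis by (simp add: F_def N_def X_def)
qed

lemma SC2_tri_faces_ge:
  assumes "finite V"
  shows "real (SC2 V (tri_faces V) 1)
    \<ge> 3 * real (card (tri_faces V)) / 4 - real (card (tri_faces_near_boundary V 4))"
proof -
  define F where "F = tri_faces V"
  define c where "c = 3 * real (card F) / 4 - real (card (tri_faces_near_boundary V 4))"
  have finF: "finite F" using assms by (simp add: F_def finite_tri_faces)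
  \<comment> \<open>Scores are natural numbers, whereas \<open>c\<close> may be fractional or
    negative; \<open>nat \<lceil>c\<rceil>\<close> is the least natural number that is at least
    \<open>c\<close>.\<close>
  have "nat \<lceil>c\<rceil> \<le> score V F 1 \<sigma> \<tau>"
    if \<sigma>: "pairing_strategy V (row_pairs V) \<sigma>" and \<tau>: "breaker_strategy V \<tau>" for \<sigma> \<tau>
  proof -
    define M where "M = maker_vertices (play \<sigma> \<tau> (card V))"
    define X where "X = {T \<in> F. T \<inter> M = {}}"
    have "4 * card X \<le> card F + 4 * card (tri_faces_near_boundary V 4)"
      unfolding X_def F_def M_def
      by (intro missed_faces_le assms pairing_strategy_claims[OF \<sigma> \<tau> assms pairing_row_pairs])
    moreover have "score V F 1 \<sigma> \<tau> = card (F - X)"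
    proof -
      have "1 \<le> card (W \<inter> M) \<longleftrightarrow> W \<inter> M \<noteq> {}" if "W \<in> F" for W
      proof -
        have "finite W" using that assms by (auto simp: F_def tri_faces_iff intro: finite_subset)
        then show ?thesis by (simp add: Suc_le_eq card_gt_0_iff)
      qed
      then have "{W \<in> F. 1 \<le> card (W \<inter> M)} = F - X" by (auto simp: X_def)
      then show ?thesis by (simp add: score_def M_def)
    qed
    moreover have "card (F - X) + card X = card F"
      using finF card_Diff_subset[of X F] card_mono[of F X]
      by (simp add: X_def finite_subset[of _ F])
    ultimately have "c \<le> real (score V F 1 \<sigma> \<tau>)" by (simp add: c_def)
    then show ?thesis by linarith
  qed
  then have "nat \<lceil>c\<rceil> \<le> SC2 V F 1"
    using finF pairing_row_pairs by (intro SC2_ge) (auto simp: pairing_guarantees_def)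
  then show ?thesis unfolding c_def F_def by linarith
qed

theorem theorem6:
  fixes V :: "nat \<Rightarrow> (int \<times> int) set"
  assumes "\<And>i. finite (V i)"
    and "two_dimensional V"
    and "filterlim (\<lambda>i. card (tri_faces (V i))) at_top sequentially"
  shows "\<exists>e :: nat \<Rightarrow> real. e \<in> o(\<lambda>i. real (card (tri_faces (V i)))) \<and>
    (\<forall>i. real (SC2 (V i) (tri_faces (V i)) 1) \<ge> 3 * real (card (tri_faces (V i))) / 4 - e i)"
proof (intro exI conjI allI)
  \<comment> \<open>The error term counts the faces within distance 4 of the boundary, which is
    \<open>two_dimensional\<close> at \<open>d = 4\<close>.\<close>
  show "(\<lambda>i. real (card (tri_faces_near_boundary (V i) 4))) \<in> o(\<lambda>i. real (card (tri_faces (V i))))"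
    using assms(2) by (simp add: two_dimensional_def)
  show "real (SC2 (V i) (tri_faces (V i)) 1) \<ge> 3 * real (card (tri_faces (V i))) / 4
      - real (card (tri_faces_near_boundary (V i) 4))" for i
    by (rule SC2_tri_faces_ge[OF assms(1)])
qed

end
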